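(* Let $\kappa$ be a field, $G$ an infinite group having a non-trivial element of finite order, and $\sigma\in pm(G)$ an idempotent factor set of $G$, i.e. $\sigma(g,h)\in\{0,1\}$ for all $g,h\in G$. Then there exist unique idempotent factor sets $\delta$ and $\lambda$ of $G$ such that: (i) $\delta$ is a diagonal factor set; (ii) $\lambda$ is a lateral factor set; (iii) $\sigma=\delta\lambda$ (pointwise product); (iv) if $\delta(x,y)=0$, then $\lambda(x,y)=1$, for all $x,y\in G$; (v) $\operatorname{Null}(\delta)\cap\operatorname{Null}(\lambda)=\varnothing$ and $\operatorname{Null}(\sigma)=\operatorname{Null}(\delta)\sqcup\operatorname{Null}(\lambda)$.
   Context: A partial projective $\sigma$-representation of $G$ in a unital (associative) $\kappa$-algebra $R$ (with $1_R\neq 0$) is a map $\Gamma:G\to R$ for which there is a function $\sigma:G\times G\to\kappa$ (called the factor set) such that for all $g,h\in G$: (i) if $\sigma(g,h)=0$ then $\Gamma(g^{-1})\Gamma(gh)=0$ and $\Gamma(gh)\Gamma(h^{-1})=0$; (ii) if $\Gamma(g)\Gamma(h)=0$ then $\sigma(g,h)=0$; (iii) $\Gamma(1_G)=1_R$; (iv) $\Gamma(g^{-1})\Gamma(g)\Gamma(h)=\sigma(g,h)\Gamma(g^{-1})\Gamma(gh)$; (v) $\Gamma(g)\Gamma(h)\Gamma(h^{-1})=\sigma(g,h)\Gamma(gh)\Gamma(h^{-1})$. The set of all factor sets of $G$ (over all such $R$ and $\Gamma$) is $pm(G)$. For a factor set $\sigma$, $\operatorname{Null}(\sigma)=\{(x,y)\in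 G\times G:\sigma(x,y)=0\}$. A diagonal factor set is one of the form $\sigma_S$, where $S\subseteq G$ satisfies $1\notin S$ and $g^{-1}\in S$ for all $g\in S$, and $\sigma_S(x,y)=0$ if $\{x,y,xy\}\cap S\neq\varnothing$, $\sigma_S(x,y)=1$ otherwise. For $a,b\in G$ let $C_{(a,b)}:=\{(a,b),(b^{-1}a^{-1},a),(b,b^{-1}a^{-1}),(b^{-1},a^{-1}),(a^{-1},ab),(ab,b^{-1})\}$. A lateral factor set is one of the form $\sigma_W$, where $W\subseteq G\times G$ satisfies $C_{(z,z^{-1})}\cap W=\varnothing$ for all $z\in G$, and $\sigma_W(a,b)=0$ if $C_{(a,b)}\cap W\neq\varnothing$, $\sigma_W(a,b)=1$ otherwise. All $\sigma_S$ and $\sigma_W$ of this form belong to $pm(G)$. *)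

theory Defs
  imports "HOL-Algebra.Algebra"
begin

text \<open>The locale \<^locale>\<open>algebra\<close> of \<^theory>\<open>HOL-Algebra.Module\<close> demands that the algebra be
  commutative, which is not wanted here.\<close>

locale unital_algebra = A: module K R + R: ring R for K (structure) and R (structure) +
  assumes smult_l: "\<lbrakk>c \<in> carrier K; a \<in> carrier R; b \<in> carrier R\<rbrakk>
      \<Longrightarrow> (c \<odot>\<^bsub>R\<^esub> a) \<otimes>\<^bsub>R\<^esub> b = c \<odot>\<^bsub>R\<^esub> (a \<otimes>\<^bsub>R\<^esub> b)"
    and smult_r: "\<lbrakk>c \<in> carrier K; a \<in> carrier R; b \<in> carrier R\<rbrakk>
      \<Longrightarrow> a \<otimes>\<^bsub>R\<^esub> (c \<odot>\<^bsub>R\<^esub> b) = c \<odot>\<^bsub>R\<^esub> (a \<otimes>\<^bsub>R\<^esub> b)"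
    and one_neq_zero: "\<one>\<^bsub>R\<^esub> \<noteq> \<zero>\<^bsub>R\<^esub>"

definition partial_proj_rep ::
  "('k, 'x) ring_scheme \<Rightarrow> ('g, 'y) monoid_scheme \<Rightarrow> ('k, 'r, 'z) module_scheme
    \<Rightarrow> ('g \<Rightarrow> 'r) \<Rightarrow> ('g \<times> 'g \<Rightarrow> 'k) \<Rightarrow> bool"
where
  "partial_proj_rep K G R \<Gamma> \<sigma> \<longleftrightarrow>
     \<Gamma> \<in> carrier G \<rightarrow> carrier R \<and>
     \<sigma> \<in> carrier G \<times> carrier G \<rightarrow> carrier K \<and>
     (\<forall>g\<in>carrier G. \<forall>h\<in>carrier G.
        (\<sigma> (g, h) = \<zero>\<^bsub>K\<^esub> \<longrightarrow>
           \<Gamma> (inv\<^bsub>G\<^esub> g) \<otimes>\<^bsub>R\<^esub> \<Gamma> (g \<otimes>\<^bsub>G\<^esub> h) = \<zero>\<^bsub>R\<^esub> \<and>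
           \<Gamma> (g \<otimes>\<^bsub>G\<^esub> h) \<otimes>\<^bsub>R\<^esub> \<Gamma> (inv\<^bsub>G\<^esub> h) = \<zero>\<^bsub>R\<^esub>) \<and>
        (\<Gamma> g \<otimes>\<^bsub>R\<^esub> \<Gamma> h = \<zero>\<^bsub>R\<^esub> \<longrightarrow> \<sigma> (g, h) = \<zero>\<^bsub>K\<^esub>) \<and>
        \<Gamma> (inv\<^bsub>G\<^esub> g) \<otimes>\<^bsub>R\<^esub> \<Gamma> g \<otimes>\<^bsub>R\<^esub> \<Gamma> h
          = \<sigma> (g, h) \<odot>\<^bsub>R\<^esub> (\<Gamma> (inv\<^bsub>G\<^esub> g) \<otimes>\<^bsub>R\<^esub> \<Gamma> (g \<otimes>\<^bsub>G\<^esub> h)) \<and>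
        \<Gamma> g \<otimes>\<^bsub>R\<^esub> \<Gamma> h \<otimes>\<^bsub>R\<^esub> \<Gamma> (inv\<^bsub>G\<^esub> h)
          = \<sigma> (g, h) \<odot>\<^bsub>R\<^esub> (\<Gamma> (g \<otimes>\<^bsub>G\<^esub> h) \<otimes>\<^bsub>R\<^esub> \<Gamma> (inv\<^bsub>G\<^esub> h))) \<and>
     \<Gamma> \<one>\<^bsub>G\<^esub> = \<one>\<^bsub>R\<^esub>"

text \<open>Factor sets are functions on \<open>G \<times> G\<close>, encoded as extensional functions so that equality of
  factor sets is equality on \<open>G \<times> G\<close>.

  A definition cannot quantify over all types of algebra elements. Replacing an algebra by its
  subalgebra generated by the image of \<open>\<Gamma>\<close> changes nothing in the conditions, and every element
  of that subalgebra is named by a formal linear combination of words over \<open>G\<close>. So algebras whose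
  elements are of type \<open>('k \<times> 'g list) list\<close> already give all factor sets; this is
  theorem \<open>pmI\<close> below, which
  holds for every type \<open>'r\<close> of elements.\<close>

definition pm :: "('k, 'x) ring_scheme \<Rightarrow> ('g, 'y) monoid_scheme \<Rightarrow> ('g \<times> 'g \<Rightarrow> 'k) set"
where
  "pm K G = {\<sigma> \<in> carrier G \<times> carrier G \<rightarrow>\<^sub>E carrier K.
     \<exists>(R :: ('k, ('k \<times> 'g list) list) module) \<Gamma>.
       unital_algebra K R \<and> partial_proj_rep K G R \<Gamma> \<sigma>}"

definition idempotent_factor_set ::
  "('k, 'x) ring_scheme \<Rightarrow> ('g, 'y) monoid_scheme \<Rightarrow> ('g \<times> 'g \<Rightarrow> 'k) \<Rightarrow> bool"
where
  "idempotent_factor_set K G \<sigma> \<longleftrightarrow>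
     \<sigma> \<in> pm K G \<and> (\<forall>g\<in>carrier G. \<forall>h\<in>carrier G. \<sigma> (g, h) \<in> {\<zero>\<^bsub>K\<^esub>, \<one>\<^bsub>K\<^esub>})"

definition Null ::
  "('k, 'x) ring_scheme \<Rightarrow> ('g, 'y) monoid_scheme \<Rightarrow> ('g \<times> 'g \<Rightarrow> 'k) \<Rightarrow> ('g \<times> 'g) set"
where
  "Null K G \<sigma> = {(x, y) \<in> carrier G \<times> carrier G. \<sigma> (x, y) = \<zero>\<^bsub>K\<^esub>}"

definition factor_set_mult ::
  "('k, 'x) ring_scheme \<Rightarrow> ('g, 'y) monoid_scheme
    \<Rightarrow> ('g \<times> 'g \<Rightarrow> 'k) \<Rightarrow> ('g \<times> 'g \<Rightarrow> 'k) \<Rightarrow> ('g \<times> 'g \<Rightarrow> 'k)"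
where
  "factor_set_mult K G \<sigma> \<tau> = (\<lambda>p \<in> carrier G \<times> carrier G. \<sigma> p \<otimes>\<^bsub>K\<^esub> \<tau> p)"

definition diagonal_of ::
  "('k, 'x) ring_scheme \<Rightarrow> ('g, 'y) monoid_scheme \<Rightarrow> 'g set \<Rightarrow> ('g \<times> 'g \<Rightarrow> 'k)"
where
  "diagonal_of K G S = (\<lambda>(x, y) \<in> carrier G \<times> carrier G.
     if {x, y, x \<otimes>\<^bsub>G\<^esub> y} \<inter> S \<noteq> {} then \<zero>\<^bsub>K\<^esub> else \<one>\<^bsub>K\<^esub>)"

definition diagonal_factor_set ::
  "('k, 'x) ring_scheme \<Rightarrow> ('g, 'y) monoid_scheme \<Rightarrow> ('g \<times> 'g \<Rightarrow> 'k) \<Rightarrow> bool"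
where
  "diagonal_factor_set K G \<sigma> \<longleftrightarrow>
     (\<exists>S \<subseteq> carrier G. \<one>\<^bsub>G\<^esub> \<notin> S \<and> (\<forall>g\<in>S. inv\<^bsub>G\<^esub> g \<in> S) \<and> \<sigma> = diagonal_of K G S)"

definition Cset :: "('g, 'y) monoid_scheme \<Rightarrow> 'g \<Rightarrow> 'g \<Rightarrow> ('g \<times> 'g) set"
where
  "Cset G a b =
     {(a, b),
      (inv\<^bsub>G\<^esub> b \<otimes>\<^bsub>G\<^esub> inv\<^bsub>G\<^esub> a, a),
      (b, inv\<^bsub>G\<^esub> b \<otimes>\<^bsub>G\<^esub> inv\<^bsub>G\<^esub> a),
      (inv\<^bsub>G\<^esub> b, inv\<^bsub>G\<^esub> a),
      (inv\<^bsub>G\<^esub> a, a \<otimes>\<^bsub>G\<^esub> b),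
      (a \<otimes>\<^bsub>G\<^esub> b, inv\<^bsub>G\<^esub> b)}"

definition lateral_of ::
  "('k, 'x) ring_scheme \<Rightarrow> ('g, 'y) monoid_scheme \<Rightarrow> ('g \<times> 'g) set \<Rightarrow> ('g \<times> 'g \<Rightarrow> 'k)"
where
  "lateral_of K G W = (\<lambda>(a, b) \<in> carrier G \<times> carrier G.
     if Cset G a b \<inter> W \<noteq> {} then \<zero>\<^bsub>K\<^esub> else \<one>\<^bsub>K\<^esub>)"

definition lateral_factor_set ::
  "('k, 'x) ring_scheme \<Rightarrow> ('g, 'y) monoid_scheme \<Rightarrow> ('g \<times> 'g \<Rightarrow> 'k) \<Rightarrow> bool"
where
  "lateral_factor_set K G \<sigma> \<longleftrightarrow>
     (\<exists>W \<subseteq> carrier G \<times> carrier G.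
        (\<forall>z\<in>carrier G. Cset G z (inv\<^bsub>G\<^esub> z) \<inter> W = {}) \<and> \<sigma> = lateral_of K G W)"

context unital_algebra
begin

primrec eval_word :: "('g \<Rightarrow> 'c) \<Rightarrow> 'g list \<Rightarrow> 'c"
where
  "eval_word \<Gamma> [] = \<one>\<^bsub>R\<^esub>"
| "eval_word \<Gamma> (g # w) = \<Gamma> g \<otimes>\<^bsub>R\<^esub> eval_word \<Gamma> w"

primrec eval_comb :: "('g \<Rightarrow> 'c) \<Rightarrow> ('a \<times> 'g list) list \<Rightarrow> 'c"
where
  "eval_comb \<Gamma> [] = \<zero>\<^bsub>R\<^esub>"
| "eval_comb \<Gamma> (t # ts) = (fst t \<odot>\<^bsub>R\<^esub> eval_word \<Gamma> (snd t)) \<oplus>\<^bsub>R\<^esub> eval_comb \<Gamma> ts"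

definition combs :: "'g set \<Rightarrow> ('a \<times> 'g list) list set"
  where "combs B = lists (carrier K \<times> lists B)"

context
  fixes \<Gamma> :: "'g \<Rightarrow> 'c" and B :: "'g set"
  assumes \<Gamma>: "\<Gamma> \<in> B \<rightarrow> carrier R"
  notes [rule del] = in_listsD
begin

abbreviation "H \<equiv> eval_comb \<Gamma> ` combs B"

lemma word_closed: "w \<in> lists B \<Longrightarrow> eval_word \<Gamma> w \<in> carrier R"
  using \<Gamma> by (induction w) auto

lemma comb_closed: "t \<in> combs B \<Longrightarrow> eval_comb \<Gamma> t \<in> carrier R"
  unfolding combs_def by (induction t) (auto simp: word_closed)

lemma word_append:
  "\<lbrakk>v \<in> lists B; w \<in> lists B\<rbrakk> \<Longrightarrow> eval_word \<Gamma> (v @ w) = eval_word \<Gamma> v \<otimes>\<^bsub>R\<^esub> eval_word \<Gamma> w"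
  using \<Gamma> by (induction v) (auto simp: word_closed R.m_assoc Pi_iff)

lemma comb_append:
  "\<lbrakk>s \<in> combs B; t \<in> combs B\<rbrakk> \<Longrightarrow> eval_comb \<Gamma> (s @ t) = eval_comb \<Gamma> s \<oplus>\<^bsub>R\<^esub> eval_comb \<Gamma> t"
proof (induction s)
  case (Cons a s)
  then show ?case
    by (auto simp: combs_def word_closed comb_closed A.M.a_assoc)
qed (auto simp: comb_closed)

lemma comb_scale:
  "\<lbrakk>c \<in> carrier K; t \<in> combs B\<rbrakk>
    \<Longrightarrow> eval_comb \<Gamma> (map (\<lambda>(d, w). (c \<otimes> d, w)) t) = c \<odot>\<^bsub>R\<^esub> eval_comb \<Gamma> t"
proof (induction t)
  case (Cons a t)
  then show ?case
    by (cases a) (auto simp: combs_def word_closed comb_closed A.smult_r_distr A.smult_assoc1)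
qed auto

lemma comb_word_left:
  "\<lbrakk>v \<in> lists B; t \<in> combs B\<rbrakk>
    \<Longrightarrow> eval_comb \<Gamma> (map (\<lambda>(d, w). (d, v @ w)) t) = eval_word \<Gamma> v \<otimes>\<^bsub>R\<^esub> eval_comb \<Gamma> t"
proof (induction t)
  case (Cons a t)
  then show ?case
    by (cases a) (auto simp: combs_def word_closed comb_closed R.r_distr smult_r word_append)
qed (auto simp: word_closed)

lemma H_sub: "H \<subseteq> carrier R"
  using comb_closed by auto

lemma H_zero: "\<zero>\<^bsub>R\<^esub> \<in> H"
  by (rule image_eqI[of _ _ "[]"]) (auto simp: combs_def)

lemma H_word: "w \<in> lists B \<Longrightarrow> eval_word \<Gamma> w \<in> H"
  by (rule image_eqI[of _ _ "[(\<one>, w)]"]) (auto simp: combs_def word_closed)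

lemma H_one: "\<one>\<^bsub>R\<^esub> \<in> H"
  using H_word[of "[]"] by simp

lemma H_gen:
  assumes "g \<in> B"
  shows "\<Gamma> g \<in> H"
proof -
  have "eval_word \<Gamma> [g] = \<Gamma> g" using \<Gamma> assms by (simp add: Pi_iff)
  then show ?thesis using H_word[of "[g]"] assms by (metis lists.Nil lists.Cons)
qed

lemma H_add: "\<lbrakk>a \<in> H; b \<in> H\<rbrakk> \<Longrightarrow> a \<oplus>\<^bsub>R\<^esub> b \<in> H"
proof (elim imageE, goal_cases)
  case (1 s t)
  then show ?case
    by (intro image_eqI[of _ _ "s @ t"]) (auto simp: comb_append, auto simp: combs_def)
qed

lemma H_smult:
  assumes c: "c \<in> carrier K" and a: "a \<in> H"
  shows "c \<odot>\<^bsub>R\<^esub> a \<in> H"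
proof -
  obtain t where t: "t \<in> combs B" "a = eval_comb \<Gamma> t" using a by auto
  have "map (\<lambda>(d, w). (c \<otimes> d, w)) t \<in> combs B"
    using t(1) c unfolding combs_def by (induction t) auto
  then show ?thesis using comb_scale[OF c t(1)] t(2) by (metis imageI)
qed

lemma H_word_left:
  assumes v: "v \<in> lists B" and a: "a \<in> H"
  shows "eval_word \<Gamma> v \<otimes>\<^bsub>R\<^esub> a \<in> H"
proof -
  obtain t where t: "t \<in> combs B" "a = eval_comb \<Gamma> t" using a by auto
  have "map (\<lambda>(d, w). (d, v @ w)) t \<in> combs B" using t(1) v unfolding combs_def by (induction t) (auto simp: in_lists_conv_set)
  then show ?thesis using comb_word_left[OF v t(1)] t(2) by (metis imageI)
qed

lemma H_mult:
  assumes a: "a \<in> H" and b: "b \<in> H"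
  shows "a \<otimes>\<^bsub>R\<^esub> b \<in> H"
proof -
  have bR: "b \<in> carrier R" using b H_sub by auto
  have "eval_comb \<Gamma> t \<otimes>\<^bsub>R\<^esub> b \<in> H" if "t \<in> combs B" for t
    using that
  proof (induction t)
    case Nil
    then show ?case using H_zero bR by simp
  next
    case (Cons x t)
    obtain c w where x: "x = (c, w)" by (cases x)
    from Cons.prems x have cw: "c \<in> carrier K" "w \<in> lists B" "t \<in> combs B"
      by (auto simp: combs_def)
    have "eval_comb \<Gamma> (x # t) \<otimes>\<^bsub>R\<^esub> b
        = c \<odot>\<^bsub>R\<^esub> (eval_word \<Gamma> w \<otimes>\<^bsub>R\<^esub> b) \<oplus>\<^bsub>R\<^esub> eval_comb \<Gamma> t \<otimes>\<^bsub>R\<^esub> b"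
      using cw bR by (simp add: x R.l_distr smult_l word_closed comb_closed)
    then show ?case
      using H_add[OF H_smult[OF cw(1) H_word_left[OF cw(2) b]] Cons.IH[OF cw(3)]] by simp
  qed
  then show ?thesis using a by auto
qed

lemma H_minus: "a \<in> H \<Longrightarrow> \<ominus>\<^bsub>R\<^esub> a \<in> H"
proof -
  assume a: "a \<in> H"
  then have "a \<in> carrier R" using H_sub by auto
  then have "\<ominus>\<^bsub>R\<^esub> a = (\<ominus> \<one>) \<odot>\<^bsub>R\<^esub> a" by (simp add: A.smult_l_minus)
  then show ?thesis using H_smult[of "\<ominus> \<one>" a] a by simp
qed

definition enc :: "'c \<Rightarrow> ('a \<times> 'g list) list"
  where "enc = inv_into (combs B) (eval_comb \<Gamma>)"

lemma dec_enc: "a \<in> H \<Longrightarrow> eval_comb \<Gamma> (enc a) = a"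
  unfolding enc_def by (rule f_inv_into_f)

definition small_algebra :: "('a, ('a \<times> 'g list) list) module"
  where "small_algebra =
    \<lparr>carrier = enc ` H,
     monoid.mult = (\<lambda>s t. enc (eval_comb \<Gamma> s \<otimes>\<^bsub>R\<^esub> eval_comb \<Gamma> t)),
     one = enc \<one>\<^bsub>R\<^esub>,
     ring.zero = enc \<zero>\<^bsub>R\<^esub>,
     add = (\<lambda>s t. enc (eval_comb \<Gamma> s \<oplus>\<^bsub>R\<^esub> eval_comb \<Gamma> t)),
     smult = (\<lambda>c t. enc (c \<odot>\<^bsub>R\<^esub> eval_comb \<Gamma> t))\<rparr>"

lemma small_sel:
  "carrier small_algebra = enc ` H"
  "\<one>\<^bsub>small_algebra\<^esub> = enc \<one>\<^bsub>R\<^esub>"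
  "\<zero>\<^bsub>small_algebra\<^esub> = enc \<zero>\<^bsub>R\<^esub>"
  "a \<in> H \<Longrightarrow> b \<in> H \<Longrightarrow> enc a \<otimes>\<^bsub>small_algebra\<^esub> enc b = enc (a \<otimes>\<^bsub>R\<^esub> b)"
  "a \<in> H \<Longrightarrow> b \<in> H \<Longrightarrow> enc a \<oplus>\<^bsub>small_algebra\<^esub> enc b = enc (a \<oplus>\<^bsub>R\<^esub> b)"
  "a \<in> H \<Longrightarrow> c \<odot>\<^bsub>small_algebra\<^esub> enc a = enc (c \<odot>\<^bsub>R\<^esub> a)"
  by (simp_all add: small_algebra_def dec_enc)

lemma enc_inj: "\<lbrakk>a \<in> H; b \<in> H\<rbrakk> \<Longrightarrow> enc a = enc b \<longleftrightarrow> a = b"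
  using dec_enc by metis

lemma small_unital_algebra: "unital_algebra K small_algebra"
proof -
  note closed = H_add H_mult H_smult H_zero H_one H_minus
  have HR: "a \<in> carrier R" if "a \<in> H" for a using that H_sub by auto
  have ball: "(\<forall>s\<in>carrier small_algebra. P s) \<longleftrightarrow> (\<forall>a\<in>H. P (enc a))" for P
    by (auto simp: small_sel)
  have carrI: "a \<in> H \<Longrightarrow> enc a \<in> carrier small_algebra" for a
    by (auto simp: small_sel)
  have carrE: "\<exists>a\<in>H. s = enc a" if "s \<in> carrier small_algebra" for s
    using that by (auto simp: small_sel)
  have ag: "abelian_group small_algebra"
  proof (rule abelian_groupI, goal_cases)
    case (1 x y)
    then show ?case by (metis carrE carrI small_sel(5) H_add)
  next
    case 2
    then show ?case by (simp add: small_sel(1,3) H_zero)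
  next
    case (3 x y z)
    obtain a b c where "a \<in> H" "b \<in> H" "c \<in> H" "x = enc a" "y = enc b" "z = enc c"
      using 3 carrE by metis
    then show ?case by (simp add: small_sel(5) H_add HR A.M.a_assoc)
  next
    case (4 x y)
    then show ?case by (metis carrE small_sel(5) A.M.a_comm HR)
  next
    case (5 x)
    then show ?case by (metis carrE small_sel(3,5) A.M.l_zero HR H_zero)
  next
    case (6 x)
    then show ?case by (metis carrE carrI small_sel(3,5) A.M.l_neg HR H_minus)
  qed
  have mon: "monoid small_algebra"
  proof (rule monoidI, goal_cases)
    case (1 x y)
    then show ?case by (metis carrE carrI small_sel(4) H_mult)
  next
    case 2
    then show ?case by (simp add: small_sel(1,2) H_one)
  next
    case (3 x y z)
    obtain a b c where "a \<in> H" "b \<in> H" "c \<in> H" "x = enc a" "y = enc b" "z = enc c"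
      using 3 carrE by metis
    then show ?case by (simp add: small_sel(4) H_mult HR R.m_assoc)
  next
    case (4 x)
    then show ?case by (metis carrE small_sel(2,4) R.l_one HR H_one)
  next
    case (5 x)
    then show ?case by (metis carrE small_sel(2,4) R.r_one HR H_one)
  qed
  have rng: "ring small_algebra"
  proof (rule ringI[OF ag mon], goal_cases)
    case (1 x y z)
    obtain a b c where "a \<in> H" "b \<in> H" "c \<in> H" "x = enc a" "y = enc b" "z = enc c"
      using 1 carrE by metis
    then show ?case by (simp add: small_sel(4,5) H_mult H_add HR R.l_distr)
  next
    case (2 x y z)
    obtain a b c where "a \<in> H" "b \<in> H" "c \<in> H" "x = enc a" "y = enc b" "z = enc c"
      using 2 carrE by metis
    then show ?case by (simp add: small_sel(4,5) H_mult H_add HR R.r_distr)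
  qed
  have mdl: "module K small_algebra"
  proof (rule moduleI[OF A.is_cring ag], goal_cases)
    case (1 c x)
    then show ?case by (metis carrE carrI small_sel(6) H_smult)
  next
    case (2 c d x)
    then obtain a where "a \<in> H" "x = enc a" using carrE by metis
    with 2 show ?case by (simp add: small_sel(5,6) H_smult HR A.smult_l_distr)
  next
    case (3 c x y)
    then obtain a b where "a \<in> H" "b \<in> H" "x = enc a" "y = enc b" using carrE by metis
    with 3 show ?case by (simp add: small_sel(5,6) H_add H_smult HR A.smult_r_distr)
  next
    case (4 c d x)
    then obtain a where "a \<in> H" "x = enc a" using carrE by metis
    with 4 show ?case by (simp add: small_sel(6) H_smult HR A.smult_assoc1)
  next
    case (5 x)
    then show ?case by (metis carrE small_sel(6) A.smult_one HR)
  qed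
  show ?thesis
  proof (rule unital_algebra.intro[OF mdl rng], unfold_locales, goal_cases)
    case (1 c x y)
    then obtain a b where "a \<in> H" "b \<in> H" "x = enc a" "y = enc b" using carrE by metis
    with 1 show ?case by (simp add: small_sel(4,6) H_mult H_smult HR smult_l)
  next
    case (2 c x y)
    then obtain a b where "a \<in> H" "b \<in> H" "x = enc a" "y = enc b" using carrE by metis
    with 2 show ?case by (simp add: small_sel(4,6) H_mult H_smult HR smult_r)
  next
    case 3
    then show ?case
      using enc_inj[OF H_one H_zero] one_neq_zero by (simp add: small_sel(2,3))
  qed
qed

lemma small_partial_proj_rep:
  assumes "group G" and "carrier G = B" and rep: "partial_proj_rep K G R \<Gamma> \<sigma>"
  shows "partial_proj_rep K G small_algebra (\<lambda>g. enc (\<Gamma> g)) \<sigma>"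
proof -
  interpret G: group G by fact
  have m: "\<Gamma> g \<in> H" if "g \<in> carrier G" for g using H_gen that assms(2) by simp
  have m2: "\<Gamma> g \<otimes>\<^bsub>R\<^esub> \<Gamma> h \<in> H" if "g \<in> carrier G" "h \<in> carrier G" for g h
    using m that H_mult by simp
  have \<sigma>: "\<sigma> (g, h) \<in> carrier K" if "g \<in> carrier G" "h \<in> carrier G" for g h
    using rep that by (auto simp: partial_proj_rep_def)
  show ?thesis
    unfolding partial_proj_rep_def
    using rep[unfolded partial_proj_rep_def]
    by (auto simp: small_sel m m2 \<sigma> H_smult H_mult H_zero H_one enc_inj)
qed

end

end

theorem pmI:
  fixes R :: "('k, 'r, 'z) module_scheme"
  assumes "group G" and "unital_algebra K R" and "partial_proj_rep K G R \<Gamma> \<sigma>"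
    and "\<sigma> \<in> extensional (carrier G \<times> carrier G)"
  shows "\<sigma> \<in> pm K G"
proof -
  interpret unital_algebra K R by fact
  have \<Gamma>: "\<Gamma> \<in> carrier G \<rightarrow> carrier R" and \<sigma>: "\<sigma> \<in> carrier G \<times> carrier G \<rightarrow> carrier K"
    using assms(3) by (auto simp: partial_proj_rep_def)
  show ?thesis
    using small_unital_algebra[OF \<Gamma>] small_partial_proj_rep[OF \<Gamma> assms(1) refl assms(3)]
      \<sigma> assms(4)
    unfolding pm_def PiE_def by blast
qed

end

theory Submission
  imports Defs
begin

text \<open>
  Think of \<open>(g, h)\<close> as the triangle \<open>{1, h, gh}\<close>, up to right translation; its edges are \<open>g\<close>, \<open>h\<close>
  and \<open>gh\<close>, and \<open>(g, g\<^sup>-\<^sup>1)\<close> is the edge \<open>g\<close> viewed as a degenerate triangle. The null set of a factor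
  set is closed under relabelling vertices, and with an edge it contains every triangle having that
  edge. Conversely, every set of pairs with these closure properties that omits \<open>(1, 1)\<close> is the null
  set of an idempotent factor set: let \<open>G\<close> act on functions on the vertices of the remaining
  triangles, by left translation compressed to each triangle.

  Let \<open>S\<close> be the set of edges \<open>g\<close> with \<open>\<sigma>(g, g\<^sup>-\<^sup>1) = 0\<close>. The zeros of \<open>\<sigma>\<close> having an edge in \<open>S\<close> form
  the null set of \<open>\<sigma>\<^sub>S\<close>, and the remaining ones contain no degenerate triangle, so they form the null
  set of a lateral factor set. Uniqueness holds because a lateral factor set has no zero at any
  \<open>(g, g\<^sup>-\<^sup>1)\<close>, so that \<open>S\<close> is determined by \<open>\<sigma>\<close>.
\<close>

section \<open>Function modules and their endomorphism algebras\<close>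

text \<open>Extensionality turns the module laws into equations between HOL functions. The domain
  will be the set of vertices of all non-null triangles.\<close>

definition function_module :: "('k, 'x) ring_scheme \<Rightarrow> 'a set \<Rightarrow> ('k, 'a \<Rightarrow> 'k) module"
where
  "function_module K D =
    \<lparr>carrier = D \<rightarrow>\<^sub>E carrier K,
     monoid.mult = (\<lambda>f g. \<lambda>x\<in>D. f x \<otimes>\<^bsub>K\<^esub> g x),
     one = (\<lambda>x\<in>D. \<one>\<^bsub>K\<^esub>),
     ring.zero = (\<lambda>x\<in>D. \<zero>\<^bsub>K\<^esub>),
     add = (\<lambda>f g. \<lambda>x\<in>D. f x \<oplus>\<^bsub>K\<^esub> g x),
     smult = (\<lambda>c f. \<lambda>x\<in>D. c \<otimes>\<^bsub>K\<^esub> f x)\<rparr>"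

lemma function_module_sel:
  "carrier (function_module K D) = D \<rightarrow>\<^sub>E carrier K"
  "\<zero>\<^bsub>function_module K D\<^esub> = (\<lambda>x\<in>D. \<zero>\<^bsub>K\<^esub>)"
  "f \<oplus>\<^bsub>function_module K D\<^esub> g = (\<lambda>x\<in>D. f x \<oplus>\<^bsub>K\<^esub> g x)"
  "c \<odot>\<^bsub>function_module K D\<^esub> f = (\<lambda>x\<in>D. c \<otimes>\<^bsub>K\<^esub> f x)"
  by (simp_all add: function_module_def)

lemma module_function_module:
  assumes "cring K"
  shows "module K (function_module K D)"
proof -
  interpret K: cring K by fact
  let ?M = "function_module K D"
  have app: "f x \<in> carrier K" if "f \<in> D \<rightarrow>\<^sub>E carrier K" "x \<in> D" for f x
    using that by auto
  have ag: "abelian_group ?M"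
  proof (rule abelian_groupI, goal_cases)
    case (3 f g h)
    then show ?case
      by (auto simp: function_module_sel app K.a_assoc intro!: ext)
  next
    case (6 f)
    then show ?case
      by (intro bexI[of _ "\<lambda>x\<in>D. \<ominus>\<^bsub>K\<^esub> f x"])
        (auto simp: function_module_sel app K.l_neg intro!: ext)
  next
    case (5 f)
    then show ?case
      unfolding function_module_sel
      by (auto simp: app restrict_def PiE_def extensional_def intro!: ext)
  qed (auto simp: function_module_sel app K.a_comm intro!: ext)
  show ?thesis
  proof (rule moduleI[OF assms ag], goal_cases)
    case (5 f)
    then show ?case
      unfolding function_module_sel
      by (auto simp: app restrict_def PiE_def extensional_def intro!: ext)
  qed (auto simp: function_module_sel app K.l_distr K.r_distr K.m_assoc intro!: ext)
qed

definition endo_algebra ::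
  "('k, 'x) ring_scheme \<Rightarrow> ('k, 'm, 'z) module_scheme \<Rightarrow> ('k, 'm \<Rightarrow> 'm) module"
where
  "endo_algebra K M =
    \<lparr>carrier = {f \<in> carrier M \<rightarrow>\<^sub>E carrier M.
       (\<forall>x\<in>carrier M. \<forall>y\<in>carrier M. f (x \<oplus>\<^bsub>M\<^esub> y) = f x \<oplus>\<^bsub>M\<^esub> f y) \<and>
       (\<forall>c\<in>carrier K. \<forall>x\<in>carrier M. f (c \<odot>\<^bsub>M\<^esub> x) = c \<odot>\<^bsub>M\<^esub> f x)},
     monoid.mult = (\<lambda>f g. \<lambda>x\<in>carrier M. f (g x)),
     one = (\<lambda>x\<in>carrier M. x),
     ring.zero = (\<lambda>x\<in>carrier M. \<zero>\<^bsub>M\<^esub>),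
     add = (\<lambda>f g. \<lambda>x\<in>carrier M. f x \<oplus>\<^bsub>M\<^esub> g x),
     smult = (\<lambda>c f. \<lambda>x\<in>carrier M. c \<odot>\<^bsub>M\<^esub> f x)\<rparr>"

lemma endo_algebra_sel:
  "f \<in> carrier (endo_algebra K M) \<longleftrightarrow> f \<in> carrier M \<rightarrow>\<^sub>E carrier M \<and>
       (\<forall>x\<in>carrier M. \<forall>y\<in>carrier M. f (x \<oplus>\<^bsub>M\<^esub> y) = f x \<oplus>\<^bsub>M\<^esub> f y) \<and>
       (\<forall>c\<in>carrier K. \<forall>x\<in>carrier M. f (c \<odot>\<^bsub>M\<^esub> x) = c \<odot>\<^bsub>M\<^esub> f x)"
  "\<one>\<^bsub>endo_algebra K M\<^esub> = (\<lambda>x\<in>carrier M. x)"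
  "\<zero>\<^bsub>endo_algebra K M\<^esub> = (\<lambda>x\<in>carrier M. \<zero>\<^bsub>M\<^esub>)"
  "f \<otimes>\<^bsub>endo_algebra K M\<^esub> g = (\<lambda>x\<in>carrier M. f (g x))"
  "f \<oplus>\<^bsub>endo_algebra K M\<^esub> g = (\<lambda>x\<in>carrier M. f x \<oplus>\<^bsub>M\<^esub> g x)"
  "c \<odot>\<^bsub>endo_algebra K M\<^esub> f = (\<lambda>x\<in>carrier M. c \<odot>\<^bsub>M\<^esub> f x)"
  by (simp_all add: endo_algebra_def)

text \<open>A nonzero vector separates the identity from the zero map, which gives
  \<open>one_neq_zero\<close>.\<close>

lemma unital_algebra_endo_algebra:
  assumes "module K M" and nz: "carrier M \<noteq> {\<zero>\<^bsub>M\<^esub>}"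
  shows "unital_algebra K (endo_algebra K M)"
proof -
  interpret M: module K M by fact
  let ?E = "endo_algebra K M"
  have app: "f x \<in> carrier M" if "f \<in> carrier M \<rightarrow>\<^sub>E carrier M" "x \<in> carrier M" for f x
    using that by auto
  have ag: "abelian_group ?E"
  proof (rule abelian_groupI, goal_cases)
    case (6 f)
    then show ?case
      by (intro bexI[of _ "\<lambda>x\<in>carrier M. \<ominus>\<^bsub>M\<^esub> f x"])
        (auto simp: endo_algebra_sel app M.M.l_neg M.M.minus_add M.smult_r_minus intro!: ext)
  next
    case (5 f)
    then show ?case
      unfolding endo_algebra_sel
      by (auto simp: app restrict_def PiE_def extensional_def intro!: ext)
  qed (auto simp: endo_algebra_sel app M.M.a_ac M.smult_r_distr intro!: ext)
  have mon: "monoid ?E"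
  proof (rule monoidI, goal_cases)
    case (4 f)
    then show ?case
      unfolding endo_algebra_sel
      by (auto simp: app restrict_def PiE_def extensional_def intro!: ext)
  next
    case (5 f)
    then show ?case
      unfolding endo_algebra_sel
      by (auto simp: app restrict_def PiE_def extensional_def intro!: ext)
  qed (auto simp: endo_algebra_sel app intro!: ext)
  have rng: "ring ?E"
    by (rule ringI[OF ag mon]) (auto simp: endo_algebra_sel app intro!: ext)
  have mdl: "module K ?E"
  proof (rule moduleI[OF M.is_cring ag], goal_cases)
    \<comment> \<open>Scalars commute in \<open>K\<close>, so a scalar multiple of a
      \<open>K\<close>-linear map is again \<open>K\<close>-linear.\<close>
    case (1 c f)
    then show ?case
      by (auto simp: endo_algebra_sel app M.smult_r_distr M.smult_assoc1[symmetric] M.R.m_comm)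
  next
    case (5 f)
    then show ?case
      unfolding endo_algebra_sel
      by (auto simp: app restrict_def PiE_def extensional_def intro!: ext)
  qed (auto simp: endo_algebra_sel app M.smult_l_distr M.smult_r_distr M.smult_assoc1 intro!: ext)
  obtain v where v: "v \<in> carrier M" "v \<noteq> \<zero>\<^bsub>M\<^esub>"
    using nz M.M.zero_closed by blast
  have "\<one>\<^bsub>?E\<^esub> \<noteq> \<zero>\<^bsub>?E\<^esub>"
    using v by (auto simp: endo_algebra_sel dest: fun_cong[of _ _ v])
  then show ?thesis
    by (intro unital_algebra.intro[OF mdl rng] unital_algebra_axioms.intro)
      (auto simp: endo_algebra_sel app intro!: ext)
qed

section \<open>Closure properties of null sets\<close>

lemma (in group) inv_cancel_left:
  assumes "x \<in> carrier G" and "y \<in> carrier G"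
  shows "inv x \<otimes> (x \<otimes> y) = y" and "x \<otimes> (inv x \<otimes> y) = y"
  using assms by (simp_all add: m_assoc[symmetric])

definition null_indicator ::
  "('k, 'x) ring_scheme \<Rightarrow> ('g, 'y) monoid_scheme \<Rightarrow> ('g \<times> 'g) set \<Rightarrow> ('g \<times> 'g \<Rightarrow> 'k)"
where
  "null_indicator K G N = (\<lambda>p\<in>carrier G \<times> carrier G. if p \<in> N then \<zero>\<^bsub>K\<^esub> else \<one>\<^bsub>K\<^esub>)"

text \<open>The maps taking (g, h) to (g^-1, gh) and to (gh, h^-1) swap adjacent vertices of the
  triangle gh, h, 1. They generate an action of the symmetric group S_3 whose orbits are the sets
  \<open>Cset G g h\<close>. Relabelling carries the edge condition from the first edge to the other
  two.\<close>

definition null_pattern :: "('g, 'y) monoid_scheme \<Rightarrow> ('g \<times> 'g) set \<Rightarrow> bool"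
where
  "null_pattern G N \<longleftrightarrow> N \<subseteq> carrier G \<times> carrier G \<and> (\<one>\<^bsub>G\<^esub>, \<one>\<^bsub>G\<^esub>) \<notin> N \<and>
     (\<forall>g\<in>carrier G. \<forall>h\<in>carrier G.
        ((g, h) \<in> N \<longrightarrow> (inv\<^bsub>G\<^esub> g, g \<otimes>\<^bsub>G\<^esub> h) \<in> N \<and> (g \<otimes>\<^bsub>G\<^esub> h, inv\<^bsub>G\<^esub> h) \<in> N) \<and>
        ((g, inv\<^bsub>G\<^esub> g) \<in> N \<longrightarrow> (g, h) \<in> N))"

text \<open>Condition (i) turns a zero of \<open>\<sigma>\<close> into two vanishing products, and
  (ii) turns these back into zeros of \<open>\<sigma>\<close>. A zero at (g, g^-1) gives
  \<Gamma>(1)\<Gamma>(g) = 0, so \<Gamma>(g) = 0 and every product \<Gamma>(g)\<Gamma>(h) vanishes.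
  A zero at (1, 1) would give 1 = 0 in the algebra.\<close>

lemma null_pattern_Null:
  fixes K :: "('k, 'x) ring_scheme" and G :: "('g, 'y) monoid_scheme"
  assumes "group G" and "field K" and "\<sigma> \<in> pm K G"
  shows "null_pattern G (Null K G \<sigma>)"
proof -
  interpret G: group G by fact
  interpret K: field K by fact
  obtain R :: "('k, ('k \<times> 'g list) list) module" and \<Gamma> where
    R: "unital_algebra K R" and rep: "partial_proj_rep K G R \<Gamma> \<sigma>"
    using assms(3) unfolding pm_def by blast
  interpret R: unital_algebra K R by fact
  have cl: "\<Gamma> g \<in> carrier R" if "g \<in> carrier G" for g
    using rep that by (auto simp: partial_proj_rep_def)
  have one: "\<Gamma> \<one>\<^bsub>G\<^esub> = \<one>\<^bsub>R\<^esub>" using rep by (auto simp: partial_proj_rep_def)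
  have i: "\<Gamma> (inv\<^bsub>G\<^esub> g) \<otimes>\<^bsub>R\<^esub> \<Gamma> (g \<otimes>\<^bsub>G\<^esub> h) = \<zero>\<^bsub>R\<^esub>"
      "\<Gamma> (g \<otimes>\<^bsub>G\<^esub> h) \<otimes>\<^bsub>R\<^esub> \<Gamma> (inv\<^bsub>G\<^esub> h) = \<zero>\<^bsub>R\<^esub>"
    if "g \<in> carrier G" "h \<in> carrier G" "\<sigma> (g, h) = \<zero>\<^bsub>K\<^esub>" for g h
    using rep that by (auto simp: partial_proj_rep_def)
  have ii: "\<sigma> (g, h) = \<zero>\<^bsub>K\<^esub>"
    if "g \<in> carrier G" "h \<in> carrier G" "\<Gamma> g \<otimes>\<^bsub>R\<^esub> \<Gamma> h = \<zero>\<^bsub>R\<^esub>" for g h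
    using rep that by (auto simp: partial_proj_rep_def)
  have "\<sigma> (\<one>\<^bsub>G\<^esub>, \<one>\<^bsub>G\<^esub>) \<noteq> \<zero>\<^bsub>K\<^esub>"
    using i(1)[of "\<one>\<^bsub>G\<^esub>" "\<one>\<^bsub>G\<^esub>"] one R.one_neq_zero by auto
  moreover have "\<sigma> (g, h) = \<zero>\<^bsub>K\<^esub>"
    if "g \<in> carrier G" "h \<in> carrier G" "\<sigma> (g, inv\<^bsub>G\<^esub> g) = \<zero>\<^bsub>K\<^esub>" for g h
    using i(2)[of g "inv\<^bsub>G\<^esub> g"] ii[of g h] that one by (simp add: cl)
  ultimately show ?thesis
    using i ii unfolding null_pattern_def Null_def by auto
qed

section \<open>Realization of a null pattern by partial translations\<close>

text \<open>Everything reduces to one geometric fact: if a point of a non-null triangle stays in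
  that triangle under successive left translation by g^-1 and h^-1, then (g, h) is not in
  \<open>N\<close>.\<close>

lemma pm_null_pattern:
  assumes "group G" and "field K" and N: "null_pattern G N"
  shows "null_indicator K G N \<in> pm K G"
proof -
  interpret G: group G by fact
  interpret K: field K by fact
  \<comment> \<open>The tag \<open>p\<close> keeps the vertices of different triangles
    apart.\<close>
  define D where "D = (SIGMA p : carrier G \<times> carrier G - N.
    {\<one>\<^bsub>G\<^esub>, snd p, fst p \<otimes>\<^bsub>G\<^esub> snd p})"
  define M where "M = function_module K D"
  define R where "R = endo_algebra K M"
  \<comment> \<open>Left translation of functions, cut off to zero where the translated point leaves
    its triangle.\<close>
  define \<Gamma> where "\<Gamma> g = (\<lambda>f\<in>carrier M. \<lambda>x\<in>D.
    if (fst x, inv\<^bsub>G\<^esub> g \<otimes>\<^bsub>G\<^esub> snd x) \<in> D then f (fst x, inv\<^bsub>G\<^esub> g \<otimes>\<^bsub>G\<^esub> snd x) else \<zero>\<^bsub>K\<^esub>)"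
    for g
  have mM: "module K M"
    unfolding M_def by (rule module_function_module) (rule K.is_cring)
  \<comment> \<open>The triangle x, y, z in coordinates invariant under right translation; (g, h)
    itself corresponds to gh, h, 1.\<close>
  define P where "P x y z \<longleftrightarrow> (x \<otimes>\<^bsub>G\<^esub> inv\<^bsub>G\<^esub> y, y \<otimes>\<^bsub>G\<^esub> inv\<^bsub>G\<^esub> z) \<notin> N" for x y z
  have N1: "(inv\<^bsub>G\<^esub> g, g \<otimes>\<^bsub>G\<^esub> h) \<in> N" "(g \<otimes>\<^bsub>G\<^esub> h, inv\<^bsub>G\<^esub> h) \<in> N"
    if "(g, h) \<in> N" for g h
    using N that unfolding null_pattern_def by auto
  have N2: "(g, h) \<in> N" if "(g, inv\<^bsub>G\<^esub> g) \<in> N" "h \<in> carrier G" for g h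
    using N that unfolding null_pattern_def by auto
  have P_swap: "P y x z" "P x z y"
    if "P x y z" "x \<in> carrier G" "y \<in> carrier G" "z \<in> carrier G" for x y z
    using that N1(1)[of "y \<otimes>\<^bsub>G\<^esub> inv\<^bsub>G\<^esub> x" "x \<otimes>\<^bsub>G\<^esub> inv\<^bsub>G\<^esub> z"]
      N1(2)[of "x \<otimes>\<^bsub>G\<^esub> inv\<^bsub>G\<^esub> z" "z \<otimes>\<^bsub>G\<^esub> inv\<^bsub>G\<^esub> y"]
    by (auto simp: P_def G.m_assoc G.inv_cancel_left G.inv_mult_group)
  have P_edge: "P x y x" if "P x y z" "x \<in> carrier G" "y \<in> carrier G" "z \<in> carrier G" for x y z
    using that N2[of "x \<otimes>\<^bsub>G\<^esub> inv\<^bsub>G\<^esub> y" "y \<otimes>\<^bsub>G\<^esub> inv\<^bsub>G\<^esub> z"]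
    by (auto simp: P_def G.inv_mult_group)
  have P_perm: "P y x z \<and> P x z y \<and> P z y x \<and> P y z x \<and> P z x y"
    if "P x y z" "x \<in> carrier G" "y \<in> carrier G" "z \<in> carrier G" for x y z
    using that P_swap by meson
  have P_degenerate: "P x y x \<and> P x x y \<and> P y x x \<and> P x x x"
    if "P x y z" "x \<in> carrier G" "y \<in> carrier G" "z \<in> carrier G" for x y z
    using that P_swap P_edge by meson
  \<comment> \<open>Repetitions must be allowed, since the points visited by two translations need
    not be distinct. Each choice is a permutation, an edge or a single point of the
    triangle.\<close>
  have P_all: "P a b c" if P: "P x y z" and abc: "a \<in> {x, y, z}" "b \<in> {x, y, z}" "c \<in> {x, y, z}"
    and carr: "x \<in> carrier G" "y \<in> carrier G" "z \<in> carrier G" for a b c x y z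
  proof -
    note perms = P P_perm[OF P carr]
    have "P u v u \<and> P u u v \<and> P v u u \<and> P u u u"
      if "u \<in> {x, y, z}" "v \<in> {x, y, z}" "u \<noteq> v" for u v
      using that perms P_degenerate carr by blast
    moreover have "P u u u" if "u \<in> {x, y, z}" for u
      using that perms P_degenerate carr by blast
    ultimately show ?thesis
      using perms abc by (cases "a = b"; cases "b = c"; cases "a = c") auto
  qed
  have D_grp: "a \<in> carrier G" if "(p, a) \<in> D" for p a
    using that by (auto simp: D_def)
  have D_P: "P a b c" if abc: "(p, a) \<in> D" "(p, b) \<in> D" "(p, c) \<in> D" for p a b c
  proof -
    obtain g h where p: "p = (g, h)" "g \<in> carrier G" "h \<in> carrier G" "(g, h) \<notin> N"
      using abc(1) by (auto simp: D_def)
    let ?A = "{g \<otimes>\<^bsub>G\<^esub> h, h, \<one>\<^bsub>G\<^esub>}"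
    from p have "P (g \<otimes>\<^bsub>G\<^esub> h) h \<one>\<^bsub>G\<^esub>"
      by (simp add: P_def G.m_assoc)
    moreover have "a \<in> ?A" "b \<in> ?A" "c \<in> ?A"
      using abc p by (auto simp: D_def)
    ultimately show ?thesis
      by (rule P_all) (simp_all add: p)
  qed
  \<comment> \<open>The points x, g^-1 x and h^-1 g^-1 x have successive quotients g and h, so
    \<open>D_P\<close> applied to them speaks of (g, h).\<close>
  have no: "(g, h) \<notin> N"
    if "(p, x) \<in> D" "(p, inv\<^bsub>G\<^esub> g \<otimes>\<^bsub>G\<^esub> x) \<in> D" "(p, inv\<^bsub>G\<^esub> h \<otimes>\<^bsub>G\<^esub> (inv\<^bsub>G\<^esub> g \<otimes>\<^bsub>G\<^esub> x)) \<in> D"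
      "g \<in> carrier G" "h \<in> carrier G" for p x g h
    using D_P[OF that(1-3)] that(4-5) D_grp[OF that(1)]
    by (simp add: P_def G.inv_mult_group G.m_assoc G.inv_cancel_left)
  have M_car: "f \<in> carrier M \<longleftrightarrow> f \<in> D \<rightarrow>\<^sub>E carrier K" for f
    by (simp add: M_def function_module_sel)
  have M_app: "f x \<in> carrier K" if "f \<in> carrier M" "x \<in> D" for f x
    using that by (auto simp: M_car)
  have "(\<one>\<^bsub>G\<^esub>, \<one>\<^bsub>G\<^esub>) \<notin> N"
    using N by (simp add: null_pattern_def)
  then have D_base: "((\<one>\<^bsub>G\<^esub>, \<one>\<^bsub>G\<^esub>), \<one>\<^bsub>G\<^esub>) \<in> D"
    by (auto simp: D_def)
  have ones: "(\<lambda>x\<in>D. \<one>\<^bsub>K\<^esub>) \<in> carrier M"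
    by (auto simp: M_car)
  have alg: "unital_algebra K R"
    unfolding R_def
  proof (rule unital_algebra_endo_algebra[OF mM])
    \<comment> \<open>Since (1, 1) is not in \<open>N\<close>, the set \<open>D\<close> is
      inhabited.\<close>
    have "(\<lambda>x\<in>D. \<one>\<^bsub>K\<^esub>) \<noteq> \<zero>\<^bsub>M\<^esub>"
      using D_base by (auto simp: M_def function_module_sel dest: fun_cong[of _ _ "((\<one>\<^bsub>G\<^esub>, \<one>\<^bsub>G\<^esub>), \<one>\<^bsub>G\<^esub>)"])
    then show "carrier M \<noteq> {\<zero>\<^bsub>M\<^esub>}" using ones by auto
  qed
  interpret R: unital_algebra K R by (rule alg)
  have \<Gamma>_M: "\<Gamma> g f \<in> carrier M" if "f \<in> carrier M" for g f
    using that by (auto simp: \<Gamma>_def M_car)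
  have \<Gamma>_app: "\<Gamma> g f (p, y) = (if (p, inv\<^bsub>G\<^esub> g \<otimes>\<^bsub>G\<^esub> y) \<in> D then f (p, inv\<^bsub>G\<^esub> g \<otimes>\<^bsub>G\<^esub> y) else \<zero>\<^bsub>K\<^esub>)"
    if "f \<in> carrier M" "(p, y) \<in> D" for g f p y
    using that by (simp add: \<Gamma>_def)
  interpret M: module K M by (rule mM)
  have M_ops: "f \<oplus>\<^bsub>M\<^esub> f' = (\<lambda>x\<in>D. f x \<oplus>\<^bsub>K\<^esub> f' x)" "c \<odot>\<^bsub>M\<^esub> f = (\<lambda>x\<in>D. c \<otimes>\<^bsub>K\<^esub> f x)"
      "\<zero>\<^bsub>M\<^esub> = (\<lambda>x\<in>D. \<zero>\<^bsub>K\<^esub>)" for f f' c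
    by (simp_all add: M_def function_module_sel)
  have \<Gamma>_R: "\<Gamma> g \<in> carrier R" for g
  proof -
    have "\<Gamma> g (f \<oplus>\<^bsub>M\<^esub> f') = \<Gamma> g f \<oplus>\<^bsub>M\<^esub> \<Gamma> g f'" if "f \<in> carrier M" "f' \<in> carrier M" for f f'
      using that M.M.add.m_closed[OF that] by (auto simp: \<Gamma>_def M_ops M_app intro!: ext)
    moreover have "\<Gamma> g (c \<odot>\<^bsub>M\<^esub> f) = c \<odot>\<^bsub>M\<^esub> \<Gamma> g f" if "c \<in> carrier K" "f \<in> carrier M" for c f
      using that M.smult_closed[OF that] by (auto simp: \<Gamma>_def M_ops M_app intro!: ext)
    moreover have "\<Gamma> g \<in> extensional (carrier M)"
      by (simp add: \<Gamma>_def)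
    ultimately show ?thesis
      using \<Gamma>_M by (auto simp: R_def endo_algebra_sel PiE_def)
  qed
  have R_M: "A f \<in> carrier M" if "A \<in> carrier R" "f \<in> carrier M" for A f
    using that by (auto simp: R_def endo_algebra_sel)
  have R_eqI: "A = B" if "A \<in> carrier R" "B \<in> carrier R"
    "\<And>f p y. f \<in> carrier M \<Longrightarrow> (p, y) \<in> D \<Longrightarrow> A f (p, y) = B f (p, y)" for A B
  proof (rule extensionalityI)
    show "A \<in> extensional (carrier M)" "B \<in> extensional (carrier M)"
      using that(1,2) by (auto simp: R_def endo_algebra_sel PiE_def)
    show "A f = B f" if f: "f \<in> carrier M" for f
    proof (rule extensionalityI)
      show "A f \<in> extensional D" "B f \<in> extensional D"
        using R_M[OF _ f] \<open>A \<in> carrier R\<close> \<open>B \<in> carrier R\<close> by (auto simp: M_car PiE_def)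
      show "A f x = B f x" if "x \<in> D" for x
        using \<open>\<And>f p y. f \<in> carrier M \<Longrightarrow> (p, y) \<in> D \<Longrightarrow> A f (p, y) = B f (p, y)\<close> f that
        by (cases x) auto
    qed
  qed
  have R_mult: "(A \<otimes>\<^bsub>R\<^esub> B) f = A (B f)" if "f \<in> carrier M" for A B f
    using that by (simp add: R_def endo_algebra_sel)
  have R_smult: "(c \<odot>\<^bsub>R\<^esub> A) f x = c \<otimes>\<^bsub>K\<^esub> A f x" if "f \<in> carrier M" "x \<in> D" for c A f x
    using that by (simp add: R_def endo_algebra_sel M_ops)
  have R_zero: "\<zero>\<^bsub>R\<^esub> f x = \<zero>\<^bsub>K\<^esub>" if "f \<in> carrier M" "x \<in> D" for f x
    using that by (simp add: R_def endo_algebra_sel M_ops)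
  have R_one: "\<one>\<^bsub>R\<^esub> f = f" if "f \<in> carrier M" for f
    using that by (simp add: R_def endo_algebra_sel)
  have rep_mult: "(\<Gamma> a \<otimes>\<^bsub>R\<^esub> \<Gamma> b) f (p, y) =
      (if (p, inv\<^bsub>G\<^esub> a \<otimes>\<^bsub>G\<^esub> y) \<in> D \<and> (p, inv\<^bsub>G\<^esub> b \<otimes>\<^bsub>G\<^esub> (inv\<^bsub>G\<^esub> a \<otimes>\<^bsub>G\<^esub> y)) \<in> D
       then f (p, inv\<^bsub>G\<^esub> b \<otimes>\<^bsub>G\<^esub> (inv\<^bsub>G\<^esub> a \<otimes>\<^bsub>G\<^esub> y)) else \<zero>\<^bsub>K\<^esub>)"
    if "f \<in> carrier M" "(p, y) \<in> D" for a b f p y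
    using that by (simp add: R_mult \<Gamma>_M \<Gamma>_app)
  have rep_mult3: "(\<Gamma> a \<otimes>\<^bsub>R\<^esub> \<Gamma> b \<otimes>\<^bsub>R\<^esub> \<Gamma> c) f (p, y) =
      (if (p, inv\<^bsub>G\<^esub> a \<otimes>\<^bsub>G\<^esub> y) \<in> D then (\<Gamma> b \<otimes>\<^bsub>R\<^esub> \<Gamma> c) f (p, inv\<^bsub>G\<^esub> a \<otimes>\<^bsub>G\<^esub> y) else \<zero>\<^bsub>K\<^esub>)"
    if "f \<in> carrier M" "(p, y) \<in> D" for a b c f p y
    using that by (simp add: R_mult \<Gamma>_M \<Gamma>_app)
  have i: "\<Gamma> (inv\<^bsub>G\<^esub> g) \<otimes>\<^bsub>R\<^esub> \<Gamma> (g \<otimes>\<^bsub>G\<^esub> h) = \<zero>\<^bsub>R\<^esub>"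
      "\<Gamma> (g \<otimes>\<^bsub>G\<^esub> h) \<otimes>\<^bsub>R\<^esub> \<Gamma> (inv\<^bsub>G\<^esub> h) = \<zero>\<^bsub>R\<^esub>"
    if gh: "g \<in> carrier G" "h \<in> carrier G" "(g, h) \<in> N" for g h
  proof (rule_tac [!] R_eqI)
    fix f p y assume f: "f \<in> carrier M" "(p, y) \<in> D"
    show "(\<Gamma> (inv\<^bsub>G\<^esub> g) \<otimes>\<^bsub>R\<^esub> \<Gamma> (g \<otimes>\<^bsub>G\<^esub> h)) f (p, y) = \<zero>\<^bsub>R\<^esub> f (p, y)"
      \<comment> \<open>The product visits y, gy and h^-1 y, so the path for (g, h) starts at gy. In
        the second product it starts at y.\<close>
      using no[of p "g \<otimes>\<^bsub>G\<^esub> y" g h] gh f D_grp[OF f(2)]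
      by (auto simp: rep_mult R_zero G.inv_mult_group G.m_assoc G.inv_cancel_left)
    show "(\<Gamma> (g \<otimes>\<^bsub>G\<^esub> h) \<otimes>\<^bsub>R\<^esub> \<Gamma> (inv\<^bsub>G\<^esub> h)) f (p, y) = \<zero>\<^bsub>R\<^esub> f (p, y)"
      using no[of p y g h] gh f D_grp[OF f(2)]
      by (auto simp: rep_mult R_zero G.inv_mult_group G.m_assoc G.inv_cancel_left)
  qed (auto simp: \<Gamma>_R)
  have ii: "(g, h) \<in> N"
    if gh: "g \<in> carrier G" "h \<in> carrier G" and zero: "\<Gamma> g \<otimes>\<^bsub>R\<^esub> \<Gamma> h = \<zero>\<^bsub>R\<^esub>" for g h
  proof (rule ccontr)
    assume "(g, h) \<notin> N"
    with gh have D: "((g, h), \<one>\<^bsub>G\<^esub>) \<in> D" "((g, h), h) \<in> D" "((g, h), g \<otimes>\<^bsub>G\<^esub> h) \<in> D"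
      by (auto simp: D_def)
    \<comment> \<open>Starting at the vertex gh of the triangle of (g, h), the path runs through gh,
      h, 1 and never leaves it.\<close>
    have "(\<Gamma> g \<otimes>\<^bsub>R\<^esub> \<Gamma> h) (\<lambda>x\<in>D. \<one>\<^bsub>K\<^esub>) ((g, h), g \<otimes>\<^bsub>G\<^esub> h) = \<one>\<^bsub>K\<^esub>"
      using gh D by (simp add: rep_mult[OF ones] G.inv_cancel_left)
    then show False
      using zero R_zero[OF ones D(3)] by simp
  qed
  let ?\<sigma> = "null_indicator K G N"
  \<comment> \<open>At y both sides test whether gy and h^-1 y are vertices and then evaluate at
    h^-1 y. By \<open>no\<close> the scalar is 1 whenever the tests succeed.\<close>
  have iv: "\<Gamma> (inv\<^bsub>G\<^esub> g) \<otimes>\<^bsub>R\<^esub> \<Gamma> g \<otimes>\<^bsub>R\<^esub> \<Gamma> h = ?\<sigma> (g, h) \<odot>\<^bsub>R\<^esub> (\<Gamma> (inv\<^bsub>G\<^esub> g) \<otimes>\<^bsub>R\<^esub> \<Gamma> (g \<otimes>\<^bsub>G\<^esub> h))"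
    if gh: "g \<in> carrier G" "h \<in> carrier G" for g h
  proof (rule R_eqI)
    fix f p y assume f: "f \<in> carrier M" "(p, y) \<in> D"
    show "(\<Gamma> (inv\<^bsub>G\<^esub> g) \<otimes>\<^bsub>R\<^esub> \<Gamma> g \<otimes>\<^bsub>R\<^esub> \<Gamma> h) f (p, y) =
        (?\<sigma> (g, h) \<odot>\<^bsub>R\<^esub> (\<Gamma> (inv\<^bsub>G\<^esub> g) \<otimes>\<^bsub>R\<^esub> \<Gamma> (g \<otimes>\<^bsub>G\<^esub> h))) f (p, y)"
      using no[of p "g \<otimes>\<^bsub>G\<^esub> y" g h] gh f D_grp[OF f(2)]
      by (auto simp: rep_mult rep_mult3 R_smult M_app null_indicator_def G.inv_mult_group
          G.m_assoc G.inv_cancel_left)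
  qed (auto simp: \<Gamma>_R gh null_indicator_def)
  have v: "\<Gamma> g \<otimes>\<^bsub>R\<^esub> \<Gamma> h \<otimes>\<^bsub>R\<^esub> \<Gamma> (inv\<^bsub>G\<^esub> h) = ?\<sigma> (g, h) \<odot>\<^bsub>R\<^esub> (\<Gamma> (g \<otimes>\<^bsub>G\<^esub> h) \<otimes>\<^bsub>R\<^esub> \<Gamma> (inv\<^bsub>G\<^esub> h))"
    if gh: "g \<in> carrier G" "h \<in> carrier G" for g h
  proof (rule R_eqI)
    fix f p y assume f: "f \<in> carrier M" "(p, y) \<in> D"
    show "(\<Gamma> g \<otimes>\<^bsub>R\<^esub> \<Gamma> h \<otimes>\<^bsub>R\<^esub> \<Gamma> (inv\<^bsub>G\<^esub> h)) f (p, y) =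
        (?\<sigma> (g, h) \<odot>\<^bsub>R\<^esub> (\<Gamma> (g \<otimes>\<^bsub>G\<^esub> h) \<otimes>\<^bsub>R\<^esub> \<Gamma> (inv\<^bsub>G\<^esub> h))) f (p, y)"
      using no[of p y g h] gh f D_grp[OF f(2)]
      by (auto simp: rep_mult rep_mult3 R_smult M_app null_indicator_def G.inv_mult_group
          G.m_assoc G.inv_cancel_left)
  qed (auto simp: \<Gamma>_R gh null_indicator_def)
  have "\<Gamma> \<one>\<^bsub>G\<^esub> = \<one>\<^bsub>R\<^esub>"
    by (rule R_eqI) (auto simp: \<Gamma>_R \<Gamma>_app R_one D_grp)
  then have "partial_proj_rep K G R \<Gamma> ?\<sigma>"
    unfolding partial_proj_rep_def using \<Gamma>_R i ii iv v by (auto simp: null_indicator_def split: if_splits)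
  then show ?thesis
    \<comment> \<open>\<open>pmI\<close> moves the representation to the element type fixed in
      \<open>pm\<close>.\<close>
    by (rule pmI[OF assms(1) alg]) (simp add: null_indicator_def)
qed

section \<open>Idempotent factor sets, diagonal and lateral ones included, as null sets\<close>

lemma Null_null_indicator:
  assumes "field K" and "N \<subseteq> carrier G \<times> carrier G"
  shows "Null K G (null_indicator K G N) = N"
proof -
  interpret K: field K by fact
  show ?thesis
    using assms(2) by (auto simp: Null_def null_indicator_def split: if_splits)
qed

text \<open>This reduces equality of idempotent factor sets to equality of their null sets.\<close>

lemma null_indicator_Null:
  assumes "idempotent_factor_set K G \<sigma>"
  shows "null_indicator K G (Null K G \<sigma>) = \<sigma>"
proof (rule extensionalityI)
  show "\<sigma> \<in> extensional (carrier G \<times> carrier G)"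
    using assms by (simp add: idempotent_factor_set_def pm_def PiE_def)
  show "null_indicator K G (Null K G \<sigma>) p = \<sigma> p" if "p \<in> carrier G \<times> carrier G" for p
  proof -
    have "\<sigma> p = \<zero>\<^bsub>K\<^esub> \<or> \<sigma> p = \<one>\<^bsub>K\<^esub>"
      using assms that by (auto simp: idempotent_factor_set_def)
    then show ?thesis
      using that by (auto simp: null_indicator_def Null_def)
  qed
qed (simp add: null_indicator_def)

lemma idempotent_null_indicator:
  assumes "group G" and "field K" and "null_pattern G N"
  shows "idempotent_factor_set K G (null_indicator K G N)"
  using pm_null_pattern[OF assms] by (auto simp: idempotent_factor_set_def null_indicator_def)

lemma diagonal_of_eq:
  "diagonal_of K G S = null_indicator K G
    {(x, y) \<in> carrier G \<times> carrier G. {x, y, x \<otimes>\<^bsub>G\<^esub> y} \<inter> S \<noteq> {}}"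
  by (auto simp: diagonal_of_def null_indicator_def intro!: ext)

text \<open>Relabelling permutes the edges up to inversion, so meeting the symmetric set
  \<open>S\<close> is invariant. The edges of (g, g^-1) are g, g^-1 and 1, so that pair meets
  \<open>S\<close> only if g lies in \<open>S\<close>.\<close>

lemma null_pattern_diagonal:
  assumes "group G" and "\<one>\<^bsub>G\<^esub> \<notin> S" and inv: "\<And>g. g \<in> S \<Longrightarrow> inv\<^bsub>G\<^esub> g \<in> S"
  shows "null_pattern G {(x, y) \<in> carrier G \<times> carrier G. {x, y, x \<otimes>\<^bsub>G\<^esub> y} \<inter> S \<noteq> {}}"
proof -
  interpret G: group G by fact
  have inv_iff: "inv\<^bsub>G\<^esub> g \<in> S \<longleftrightarrow> g \<in> S" if "g \<in> carrier G" for g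
    using inv[of g] inv[of "inv\<^bsub>G\<^esub> g"] that by auto
  show ?thesis
    using assms(2) by (auto simp: null_pattern_def inv_iff G.m_assoc G.inv_cancel_left)
qed

text \<open>\<open>Cset G a b\<close> is the orbit of (a, b) under relabelling, so an invariant
  \<open>W\<close> meets it exactly when it contains (a, b).\<close>

lemma lateral_of_eq:
  assumes "group G" and W: "null_pattern G W"
  shows "lateral_of K G W = null_indicator K G W"
proof -
  interpret G: group G by fact
  have l: "(inv\<^bsub>G\<^esub> g, g \<otimes>\<^bsub>G\<^esub> h) \<in> W" and r: "(g \<otimes>\<^bsub>G\<^esub> h, inv\<^bsub>G\<^esub> h) \<in> W" if "(g, h) \<in> W" for g h
    using W that unfolding null_pattern_def by auto
  have "Cset G a b \<inter> W \<noteq> {} \<longleftrightarrow> (a, b) \<in> W" if ab: "a \<in> carrier G" "b \<in> carrier G" for a b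
  proof
    note simps = G.inv_mult_group G.m_assoc G.inv_cancel_left
    \<comment> \<open>The first two cases undo one swap; each later one moves by a swap to a pair
      already treated.\<close>
    have 1: "(a, b) \<in> W" if "(inv\<^bsub>G\<^esub> a, a \<otimes>\<^bsub>G\<^esub> b) \<in> W"
      using l[OF that] ab by (simp add: simps)
    have 2: "(a, b) \<in> W" if "(a \<otimes>\<^bsub>G\<^esub> b, inv\<^bsub>G\<^esub> b) \<in> W"
      using r[OF that] ab by (simp add: simps)
    have 3: "(a, b) \<in> W" if "(b, inv\<^bsub>G\<^esub> b \<otimes>\<^bsub>G\<^esub> inv\<^bsub>G\<^esub> a) \<in> W"
      using r[OF that] ab by (intro 1) (simp add: simps)
    have 4: "(a, b) \<in> W" if "(inv\<^bsub>G\<^esub> b, inv\<^bsub>G\<^esub> a) \<in> W"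
      using l[OF that] ab by (intro 3) (simp add: simps)
    have 5: "(a, b) \<in> W" if "(inv\<^bsub>G\<^esub> b \<otimes>\<^bsub>G\<^esub> inv\<^bsub>G\<^esub> a, a) \<in> W"
      using r[OF that] ab by (intro 4) (simp add: simps)
    show "(a, b) \<in> W" if "Cset G a b \<inter> W \<noteq> {}"
      using that 1 2 3 4 5 unfolding Cset_def by blast
  qed (auto simp: Cset_def)
  then show ?thesis
    by (auto simp: lateral_of_def null_indicator_def intro!: ext)
qed

section \<open>Existence of the decomposition\<close>

text \<open>The factors have null sets \<open>\<Delta>\<close> and \<open>N - \<Delta>\<close>. Both
  are null patterns, so \<open>pm_null_pattern\<close> makes both indicators factor sets.\<close>

lemma diagonal_lateral_decomposition_exists:
  assumes "field K" and "group G" and \<sigma>: "idempotent_factor_set K G \<sigma>"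
  obtains \<delta> \<mu> where "idempotent_factor_set K G \<delta>" "idempotent_factor_set K G \<mu>"
    "diagonal_factor_set K G \<delta>" "lateral_factor_set K G \<mu>"
    "Null K G \<delta> \<inter> Null K G \<mu> = {}" "Null K G \<sigma> = Null K G \<delta> \<union> Null K G \<mu>"
proof -
  interpret G: group G by fact
  define N where "N = Null K G \<sigma>"
  define S where "S = {x \<in> carrier G. (x, inv\<^bsub>G\<^esub> x) \<in> N}"
  define \<Delta> where "\<Delta> = {(x, y) \<in> carrier G \<times> carrier G. {x, y, x \<otimes>\<^bsub>G\<^esub> y} \<inter> S \<noteq> {}}"
  have N: "null_pattern G N"
    unfolding N_def using \<sigma> by (intro null_pattern_Null assms) (simp add: idempotent_factor_set_def)
  then have N_one: "(\<one>\<^bsub>G\<^esub>, \<one>\<^bsub>G\<^esub>) \<notin> N" and N_sub: "N \<subseteq> carrier G \<times> carrier G"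
    and N_l: "\<And>g h. (g, h) \<in> N \<Longrightarrow> (inv\<^bsub>G\<^esub> g, g \<otimes>\<^bsub>G\<^esub> h) \<in> N"
    and N_r: "\<And>g h. (g, h) \<in> N \<Longrightarrow> (g \<otimes>\<^bsub>G\<^esub> h, inv\<^bsub>G\<^esub> h) \<in> N"
    and N_S: "\<And>g h. g \<in> S \<Longrightarrow> h \<in> carrier G \<Longrightarrow> (g, h) \<in> N"
    unfolding null_pattern_def S_def by auto
  have S_inv: "inv\<^bsub>G\<^esub> g \<in> S" if "g \<in> S" for g
    using N_l[OF N_S[OF that, of "\<one>\<^bsub>G\<^esub>"]] that by (simp add: S_def)
  have S_one: "\<one>\<^bsub>G\<^esub> \<notin> S"
    using N_one by (simp add: S_def)
  have edge_l: "g \<in> S" if "(\<one>\<^bsub>G\<^esub>, g) \<in> N" for g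
    using N_r[OF that] N_sub that by (auto simp: S_def)
  have edge_r: "g \<in> S" if "(g, \<one>\<^bsub>G\<^esub>) \<in> N" for g
  proof -
    have g: "g \<in> carrier G" using N_sub that by auto
    then have "inv\<^bsub>G\<^esub> g \<in> S" using N_l[OF that] by (simp add: S_def)
    then show ?thesis using S_inv[of "inv\<^bsub>G\<^esub> g"] g by simp
  qed
  have \<Delta>: "null_pattern G \<Delta>"
    unfolding \<Delta>_def by (rule null_pattern_diagonal[OF \<open>group G\<close> S_one S_inv])
  have "(x, y) \<in> N" if xy_\<Delta>: "(x, y) \<in> \<Delta>" for x y
  proof -
    have xy: "x \<in> carrier G" "y \<in> carrier G" using that by (auto simp: \<Delta>_def)
    \<comment> \<open>\<open>N_S\<close> handles an edge in first position only. The other edges are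
      brought there by passing to (y^-1, x^-1) and (xy, y^-1), and swaps lead back to (x,
      y).\<close>
    consider "x \<in> S" | "inv\<^bsub>G\<^esub> y \<in> S" | "x \<otimes>\<^bsub>G\<^esub> y \<in> S"
      using xy_\<Delta> S_inv[of y] by (auto simp: \<Delta>_def)
    then show ?thesis
    proof cases
      case 1
      then show ?thesis using N_S xy by simp
    next
      case 2
      then have "(inv\<^bsub>G\<^esub> y, inv\<^bsub>G\<^esub> x) \<in> N" using N_S xy by simp
      from N_l[OF N_r[OF N_l[OF this]]] show ?thesis
        using xy by (simp add: G.inv_mult_group G.m_assoc G.inv_cancel_left)
    next
      case 3
      then have "(x \<otimes>\<^bsub>G\<^esub> y, inv\<^bsub>G\<^esub> y) \<in> N" using N_S xy by simp
      from N_r[OF this] show ?thesis using xy by (simp add: G.m_assoc)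
    qed
  qed
  then have \<Delta>_N: "\<Delta> \<subseteq> N" by auto
  \<comment> \<open>The forward implications show that the complement of \<open>\<Delta>\<close> is
    also closed under relabelling.\<close>
  have \<Delta>_l: "(inv\<^bsub>G\<^esub> g, g \<otimes>\<^bsub>G\<^esub> h) \<in> \<Delta> \<longleftrightarrow> (g, h) \<in> \<Delta>"
    and \<Delta>_r: "(g \<otimes>\<^bsub>G\<^esub> h, inv\<^bsub>G\<^esub> h) \<in> \<Delta> \<longleftrightarrow> (g, h) \<in> \<Delta>" if "g \<in> carrier G" "h \<in> carrier G" for g h
    using that S_inv[of g] S_inv[of "inv\<^bsub>G\<^esub> g"] S_inv[of h] S_inv[of "inv\<^bsub>G\<^esub> h"]
    by (auto simp: \<Delta>_def G.inv_cancel_left G.m_assoc)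
  \<comment> \<open>Such a pair in \<open>N\<close> puts g into \<open>S\<close> and hence the pair
    into \<open>\<Delta>\<close>. The edge condition for \<open>N - \<Delta>\<close> is therefore
    vacuous.\<close>
  have W_inv: "(g, inv\<^bsub>G\<^esub> g) \<notin> N - \<Delta>" for g
    using N_sub by (auto simp: \<Delta>_def S_def)
  then have W: "null_pattern G (N - \<Delta>)"
    using N_sub N_one N_l N_r \<Delta>_l \<Delta>_r unfolding null_pattern_def by auto
  have W_S: "(x, y) \<notin> N - \<Delta>" if "x \<in> S \<or> y \<in> S" for x y
    using that N_sub by (auto simp: \<Delta>_def)
  show thesis
  proof
    show "idempotent_factor_set K G (diagonal_of K G S)"
      unfolding diagonal_of_eq \<Delta>_def[symmetric]
      by (rule idempotent_null_indicator[OF assms(2,1) \<Delta>])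
    show "idempotent_factor_set K G (lateral_of K G (N - \<Delta>))"
      unfolding lateral_of_eq[OF \<open>group G\<close> W]
      by (rule idempotent_null_indicator[OF assms(2,1) W])
    show "diagonal_factor_set K G (diagonal_of K G S)"
      unfolding diagonal_factor_set_def
      by (intro exI[of _ S] conjI ballI refl S_one S_inv) (auto simp: S_def)
    \<comment> \<open>Here the orbit collapses to (z, z^-1), (1, z) and (z^-1, 1). If one of the
      last two lies in \<open>N\<close>, its edge is in \<open>S\<close>, so it lies in
      \<open>\<Delta>\<close>.\<close>
    have "Cset G z (inv\<^bsub>G\<^esub> z) \<inter> (N - \<Delta>) = {}" if z: "z \<in> carrier G" for z
    proof -
      have edges: "(\<one>\<^bsub>G\<^esub>, g) \<notin> N - \<Delta>" "(g, \<one>\<^bsub>G\<^esub>) \<notin> N - \<Delta>" for g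
        using W_S[of "\<one>\<^bsub>G\<^esub>" g] W_S[of g "\<one>\<^bsub>G\<^esub>"] edge_l[of g] edge_r[of g] by blast+
      have "(z, inv\<^bsub>G\<^esub> z) \<notin> N - \<Delta>"
        by (rule W_inv)
      moreover from W_inv[of "inv\<^bsub>G\<^esub> z"] have "(inv\<^bsub>G\<^esub> z, z) \<notin> N - \<Delta>"
        using z by simp
      ultimately show ?thesis
        using z edges by (simp add: Cset_def)
    qed
    then show "lateral_factor_set K G (lateral_of K G (N - \<Delta>))"
      unfolding lateral_factor_set_def using N_sub
      by (intro exI[of _ "N - \<Delta>"] conjI ballI refl) blast+
    have Null_\<delta>: "Null K G (diagonal_of K G S) = \<Delta>"
      unfolding diagonal_of_eq \<Delta>_def by (rule Null_null_indicator[OF assms(1)]) auto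
    have Null_\<mu>: "Null K G (lateral_of K G (N - \<Delta>)) = N - \<Delta>"
      unfolding lateral_of_eq[OF \<open>group G\<close> W] using N_sub by (intro Null_null_indicator assms(1)) auto
    show "Null K G (diagonal_of K G S) \<inter> Null K G (lateral_of K G (N - \<Delta>)) = {}"
      "Null K G \<sigma> = Null K G (diagonal_of K G S) \<union> Null K G (lateral_of K G (N - \<Delta>))"
      unfolding Null_\<delta> Null_\<mu> N_def[symmetric] using \<Delta>_N by auto
  qed
qed

section \<open>Uniqueness and the final theorem\<close>

text \<open>The edges of (z, z^-1) are z, z^-1 and 1, so the diagonal factor set of a symmetric
  \<open>S\<close> omitting 1 vanishes there exactly when z lies in \<open>S\<close>. Thus
  \<open>S\<close> can be read off.\<close>

lemma diagonal_factor_set_unique: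
  assumes "field K" and "group G"
    and "diagonal_factor_set K G \<delta>" and "diagonal_factor_set K G \<delta>'"
    and eq: "\<And>z. z \<in> carrier G \<Longrightarrow> (z, inv\<^bsub>G\<^esub> z) \<in> Null K G \<delta> \<longleftrightarrow> (z, inv\<^bsub>G\<^esub> z) \<in> Null K G \<delta>'"
  shows "\<delta> = \<delta>'"
proof -
  interpret G: group G by fact
  interpret K: field K by fact
  have char: "S = {z \<in> carrier G. (z, inv\<^bsub>G\<^esub> z) \<in> Null K G (diagonal_of K G S)}"
    if "S \<subseteq> carrier G" "\<one>\<^bsub>G\<^esub> \<notin> S" "\<forall>g\<in>S. inv\<^bsub>G\<^esub> g \<in> S" for S
    using that by (auto simp: Null_def diagonal_of_def split: if_splits)
  obtain S where S: "S \<subseteq> carrier G" "\<one>\<^bsub>G\<^esub> \<notin> S" "\<forall>g\<in>S. inv\<^bsub>G\<^esub> g \<in> S"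
    and \<delta>: "\<delta> = diagonal_of K G S"
    using assms(3) unfolding diagonal_factor_set_def by auto
  obtain S' where S': "S' \<subseteq> carrier G" "\<one>\<^bsub>G\<^esub> \<notin> S'" "\<forall>g\<in>S'. inv\<^bsub>G\<^esub> g \<in> S'"
    and \<delta>': "\<delta>' = diagonal_of K G S'"
    using assms(4) unfolding diagonal_factor_set_def by auto
  have "S = {z \<in> carrier G. (z, inv\<^bsub>G\<^esub> z) \<in> Null K G \<delta>}"
    unfolding \<delta> by (rule char[OF S])
  also have "\<dots> = {z \<in> carrier G. (z, inv\<^bsub>G\<^esub> z) \<in> Null K G \<delta>'}"
    using eq by blast
  also have "\<dots> = S'"
    unfolding \<delta>' by (rule char[OF S', symmetric])
  finally show ?thesis
    using \<delta> \<delta>' by simp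
qed

lemma lateral_inverse_notin_Null:
  assumes "field K" and "lateral_factor_set K G \<mu>" and "z \<in> carrier G"
  shows "(z, inv\<^bsub>G\<^esub> z) \<notin> Null K G \<mu>"
proof -
  interpret K: field K by fact
  show ?thesis
    using assms(2,3) by (auto simp: lateral_factor_set_def lateral_of_def Null_def)
qed

theorem theorem9p16:
  fixes K :: "('k, 'x) ring_scheme" and G :: "('g, 'y) monoid_scheme"
    and \<sigma> :: "'g \<times> 'g \<Rightarrow> 'k"
  assumes "field K" and "group G" and "infinite (carrier G)"
    and "\<exists>x\<in>carrier G. x \<noteq> \<one>\<^bsub>G\<^esub> \<and> (\<exists>n::nat. 0 < n \<and> x [^]\<^bsub>G\<^esub> n = \<one>\<^bsub>G\<^esub>)"
    and "idempotent_factor_set K G \<sigma>"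
  shows "\<exists>!(\<delta>, \<mu>).
    idempotent_factor_set K G \<delta> \<and> idempotent_factor_set K G \<mu> \<and>
    diagonal_factor_set K G \<delta> \<and>
    lateral_factor_set K G \<mu> \<and>
    \<sigma> = factor_set_mult K G \<delta> \<mu> \<and>
    (\<forall>x\<in>carrier G. \<forall>y\<in>carrier G. \<delta> (x, y) = \<zero>\<^bsub>K\<^esub> \<longrightarrow> \<mu> (x, y) = \<one>\<^bsub>K\<^esub>) \<and>
    Null K G \<delta> \<inter> Null K G \<mu> = {} \<and>
    Null K G \<sigma> = Null K G \<delta> \<union> Null K G \<mu>"
    (is "\<exists>!(\<delta>, \<mu>). ?P \<delta> \<mu>")
proof -
  interpret K: field K by fact
  obtain \<delta> \<mu> where dec: "idempotent_factor_set K G \<delta>" "idempotent_factor_set K G \<mu>"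
    "diagonal_factor_set K G \<delta>" "lateral_factor_set K G \<mu>"
    "Null K G \<delta> \<inter> Null K G \<mu> = {}" "Null K G \<sigma> = Null K G \<delta> \<union> Null K G \<mu>"
    using diagonal_lateral_decomposition_exists[OF assms(1,2,5)] by blast
  \<comment> \<open>For values 0 and 1 a product vanishes exactly when a factor does, so the
    statement on null sets yields the product formula.\<close>
  have mult: "factor_set_mult K G \<delta> \<mu> = null_indicator K G (Null K G \<delta> \<union> Null K G \<mu>)"
  proof (rule extensionalityI)
    show "factor_set_mult K G \<delta> \<mu> p = null_indicator K G (Null K G \<delta> \<union> Null K G \<mu>) p"
      if "p \<in> carrier G \<times> carrier G" for p
    proof -
      have "\<delta> p = \<zero>\<^bsub>K\<^esub> \<or> \<delta> p = \<one>\<^bsub>K\<^esub>" "\<mu> p = \<zero>\<^bsub>K\<^esub> \<or> \<mu> p = \<one>\<^bsub>K\<^esub>"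
        using dec(1,2) that by (auto simp: idempotent_factor_set_def)
      then show ?thesis
        using that by (auto simp: factor_set_mult_def null_indicator_def Null_def)
    qed
  qed (simp_all add: factor_set_mult_def null_indicator_def)
  have ex: "?P \<delta> \<mu>"
  proof (intro conjI ballI impI dec)
    show "\<sigma> = factor_set_mult K G \<delta> \<mu>"
      using null_indicator_Null[OF assms(5)] dec(6) mult by simp
    show "\<mu> (x, y) = \<one>\<^bsub>K\<^esub>" if "x \<in> carrier G" "y \<in> carrier G" "\<delta> (x, y) = \<zero>\<^bsub>K\<^esub>" for x y
      using that dec(2,5) by (auto simp: Null_def idempotent_factor_set_def)
  qed
  have uniq: "\<delta>' = \<delta> \<and> \<mu>' = \<mu>" if P: "?P \<delta>' \<mu>'" for \<delta>' \<mu>'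
  proof -
    have "\<delta>' = \<delta>"
    proof (rule diagonal_factor_set_unique[OF assms(1,2)])
      \<comment> \<open>Neither lateral factor vanishes at (z, z^-1), so both sides say that
        \<open>\<sigma>\<close> vanishes there.\<close>
      show "(z, inv\<^bsub>G\<^esub> z) \<in> Null K G \<delta>' \<longleftrightarrow> (z, inv\<^bsub>G\<^esub> z) \<in> Null K G \<delta>" if z: "z \<in> carrier G" for z
        using P ex lateral_inverse_notin_Null[OF assms(1) _ z] by blast
    qed (use P ex in blast)+
    \<comment> \<open>By disjointness both are the complement of \<open>Null K G \<delta>\<close> in
      \<open>Null K G \<sigma>\<close>.\<close>
    moreover from this have "Null K G \<mu>' = Null K G \<mu>"
      using P ex by blast
    then have "\<mu>' = \<mu>"
      using P ex null_indicator_Null by metis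
    ultimately show ?thesis by simp
  qed
  show ?thesis
    using ex uniq by (intro ex1I[of _ "(\<delta>, \<mu>)"]) auto
qed

end
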